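(* Let $k$ and $m$ be positive integers. Suppose we have $m$ Hadamard matrices $A_1, A_2, \ldots, A_m$ of order $k$ (not necessarily distinct) and $k$ Hadamard matrices $B_1, B_2, \ldots, B_k$ of order $m$ (also not necessarily distinct), all written over $\{0,1\}$. For $j=1,\ldots,m$ and $i=1,\ldots,k$, let $a^{(j)}_i \in \{0,1\}^k$ denote the $i$-th row of $A_j$, and for $u=1,\ldots,k$ let $B_u = [b^{(u)}_{r,s}]$, $r,s=1,\ldots,m$. Let $H$ be the $mk\times mk$ matrix over $\{0,1\}$ consisting of $m$ consecutive horizontal blocks of $k$ rows each, where for $r=1,\ldots,m$ and $u=1,\ldots,k$ the $u$-th row of the $r$-th block (that is, row number $(r-1)k+u$ of $H$) is the concatenation $$\left[\; a^{(1)}_u + b^{(u)}_{r,1} \;\middle|\; a^{(2)}_u + b^{(u)}_{r,2} \;\middle|\; \cdots \;\middle|\; a^{(m)}_u + b^{(u)}_{r,m} \;\right].$$ Then $H$ is a Hadamard matrix of order $mk$.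
   Context: A Hadamard matrix of order $n$ is an $n\times n$ matrix $M$ with entries $+1$ and $-1$ such that $MM^T = nI$, where $I$ is the $n\times n$ identity matrix. A matrix over $\{0,1\}$ is called a Hadamard matrix (over $\{0,1\}$) if replacing every $0$ by $+1$ and every $1$ by $-1$ gives a Hadamard matrix in this sense. For a binary vector $a\in\{0,1\}^k$ and $e\in\{0,1\}$, $a+e$ denotes the vector $a + e(1,1,\ldots,1)$, with addition modulo $2$ in each coordinate (so $a+0=a$, and $a+1$ is the complement of $a$). *)

theory Defs
  imports "Jordan_Normal_Form.Matrix" "HOL-Library.Z2"
begin

definition hadamard_matrix :: "nat \<Rightarrow> int mat \<Rightarrow> bool" where
  "hadamard_matrix n M \<longleftrightarrow>
     M \<in> carrier_mat n n \<and> (\<forall>i<n. \<forall>j<n. M $$ (i, j) \<in> {1, -1}) \<and>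
     M * transpose_mat M = int n \<cdot>\<^sub>m 1\<^sub>m n"

definition sign_of_bit :: "bit \<Rightarrow> int" where
  "sign_of_bit b = (if b = 0 then 1 else -1)"

definition binary_hadamard_matrix :: "nat \<Rightarrow> bit mat \<Rightarrow> bool" where
  "binary_hadamard_matrix n M \<longleftrightarrow> hadamard_matrix n (map_mat sign_of_bit M)"

text \<open>Addition on type \<^typ>\<open>bit\<close> is addition modulo 2.\<close>

definition shift_vec :: "bit vec \<Rightarrow> bit \<Rightarrow> bit vec" where
  "shift_vec a e = a + e \<cdot>\<^sub>v vec (dim_vec a) (\<lambda>_. 1)"

definition concat_vec :: "'a vec list \<Rightarrow> 'a vec" where
  "concat_vec vs = vec_of_list (concat (map list_of_vec vs))"

text \<open>All indices count from 0, so the row at position \<open>u\<close> of block \<open>r\<close> is row \<open>r * k + u\<close>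
  of the whole matrix.\<close>

definition composite_row ::
  "nat \<Rightarrow> (nat \<Rightarrow> bit mat) \<Rightarrow> (nat \<Rightarrow> bit mat) \<Rightarrow> nat \<Rightarrow> nat \<Rightarrow> bit vec" where
  "composite_row m A B r u =
     concat_vec (map (\<lambda>j. shift_vec (row (A j) u) (B u $$ (r, j))) [0..<m])"

definition composite_matrix ::
  "nat \<Rightarrow> nat \<Rightarrow> (nat \<Rightarrow> bit mat) \<Rightarrow> (nat \<Rightarrow> bit mat) \<Rightarrow> bit mat" where
  "composite_matrix k m A B =
     mat_of_rows (m * k)
       (concat (map (\<lambda>r. map (\<lambda>u. composite_row m A B r u) [0..<k]) [0..<m]))"

end

theory Submission
  imports Defs
begin

text \<open>
  Written with signs, the row of \<open>H\<close> at position \<open>u\<close> of block \<open>r\<close> has the entry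
  \<open>A\<^sub>j(u,c) B\<^sub>u(r,j)\<close> in column \<open>j k + c\<close>, because addition modulo 2 of bits is multiplication
  of signs. The inner product of the rows \<open>(r,u)\<close> and \<open>(r',u')\<close> is therefore
  \<open>\<Sum>j. B\<^sub>u(r,j) B\<^sub>u\<^sub>'(r',j) (\<Sum>c. A\<^sub>j(u,c) A\<^sub>j(u',c))\<close>.
  Each inner sum is an inner product of rows of the one Hadamard matrix \<open>A\<^sub>j\<close>, hence \<open>k\<close> if
  \<open>u = u'\<close> and \<open>0\<close> otherwise, independently of \<open>j\<close>. So the product vanishes for \<open>u \<noteq> u'\<close>, whatever
  the two matrices \<open>B\<^sub>u\<close> and \<open>B\<^sub>u\<^sub>'\<close> are. For \<open>u = u'\<close> only one matrix \<open>B\<^sub>u\<close> is involved, and what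
  remains is \<open>k\<close> times an inner product of its rows, that is \<open>k m\<close> if \<open>r = r'\<close> and \<open>0\<close> otherwise.

  The lemma \<open>composite_matrix_index\<close> gives the entries of \<open>H\<close> by division with remainder of the row
  and column numbers by \<open>k\<close>; \<open>binary_hadamard_matrix_iff\<close> restates the Hadamard property
  as row orthogonality, in which the calculation above can be carried out.
\<close>

lemma sign_of_bit_add: "sign_of_bit (a + b) = sign_of_bit a * sign_of_bit b"
  by (cases a; cases b) (simp_all add: sign_of_bit_def)

text \<open>The sign entries are \<open>1\<close> or \<open>-1\<close> automatically, so only the size of the matrix and the
  inner products of its rows matter.\<close>

lemma binary_hadamard_matrix_iff:
  "binary_hadamard_matrix n M \<longleftrightarrow>
     M \<in> carrier_mat n n \<and>
     (\<forall>i<n. \<forall>j<n. (\<Sum>c<n. sign_of_bit (M $$ (i, c)) * sign_of_bit (M $$ (j, c))) =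
        (if i = j then int n else 0))"
proof (cases "M \<in> carrier_mat n n")
  case True
  let ?S = "map_mat sign_of_bit M"
  have gram: "(?S * transpose_mat ?S) $$ (i, j) =
      (\<Sum>c<n. sign_of_bit (M $$ (i, c)) * sign_of_bit (M $$ (j, c)))" if "i < n" "j < n" for i j
    using True that by (auto simp: scalar_prod_def lessThan_atLeast0 intro!: sum.cong)
  have "?S * transpose_mat ?S = int n \<cdot>\<^sub>m 1\<^sub>m n \<longleftrightarrow>
      (\<forall>i<n. \<forall>j<n. (?S * transpose_mat ?S) $$ (i, j) = (if i = j then int n else 0))"
    using True by (auto simp: mat_eq_iff simp del: index_mult_mat(1))
  moreover have "\<forall>i<n. \<forall>j<n. ?S $$ (i, j) \<in> {1, -1}"
    using True by (auto simp: sign_of_bit_def)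
  ultimately show ?thesis
    using True gram by (simp add: binary_hadamard_matrix_def hadamard_matrix_def)
qed (auto simp: binary_hadamard_matrix_def hadamard_matrix_def)

lemma length_concat_uniform:
  assumes "\<And>i. i < m \<Longrightarrow> length (f i) = k"
  shows "length (concat (map f [0..<m])) = m * k"
  using assms by (induction m) auto

text \<open>Both the rows of \<open>H\<close> and the blocks within a row are laid out as a concatenation of lists of
  one common length \<open>k\<close>, so this fact locates rows as well as columns.\<close>

lemma nth_concat_uniform:
  assumes "\<And>i. i < m \<Longrightarrow> length (f i) = k" and "p < m * k"
  shows "concat (map f [0..<m]) ! p = f (p div k) ! (p mod k)"
  using assms
proof (induction m)
  case (Suc m)
  have len: "length (concat (map f [0..<m])) = m * k"
    using Suc.prems(1) by (intro length_concat_uniform) simp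
  show ?case
  proof (cases "p < m * k")
    case True
    then show ?thesis using Suc len by (simp add: nth_append)
  next
    case False
    define c where "c = p - m * k"
    have "p = m * k + c" "c < k" using False Suc.prems(2) by (auto simp: c_def)
    then show ?thesis using len by (simp add: nth_append)
  qed
qed simp

lemma composite_row_index:
  assumes "\<And>j. j < m \<Longrightarrow> A j \<in> carrier_mat k k" and "u < k" and q: "q < m * k"
  shows "composite_row m A B r u $ q = A (q div k) $$ (u, q mod k) + B u $$ (r, q div k)"
proof -
  define f where "f j = list_of_vec (shift_vec (row (A j) u) (B u $$ (r, j)))" for j
  have row_eq: "composite_row m A B r u = vec_of_list (concat (map f [0..<m]))"
    by (simp add: composite_row_def concat_vec_def f_def[abs_def] comp_def)
  have len: "length (f j) = k" if "j < m" for j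
    using assms(1)[OF that] by (simp add: f_def shift_vec_def)
  have "k > 0" "q div k < m"
    using q less_mult_imp_div_less by (auto intro: gr0I)
  then have "f (q div k) ! (q mod k) = A (q div k) $$ (u, q mod k) + B u $$ (r, q div k)"
    using assms(1)[of "q div k"] assms(2)
    by (simp add: f_def shift_vec_def list_of_vec_index)
  then show ?thesis
    using nth_concat_uniform[of m f k q] len q by (simp add: row_eq vec_of_list_index)
qed

lemma composite_matrix_carrier:
  "composite_matrix k m A B \<in> carrier_mat (m * k) (m * k)"
proof -
  let ?f = "\<lambda>r. map (\<lambda>u. composite_row m A B r u) [0..<k]"
  have "length (concat (map ?f [0..<m])) = m * k"
    by (rule length_concat_uniform) simp
  then show ?thesis
    unfolding composite_matrix_def by (metis mat_of_rows_carrier(1))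
qed

lemma composite_matrix_index:
  assumes "\<And>j. j < m \<Longrightarrow> A j \<in> carrier_mat k k" and "p < m * k" and "q < m * k"
  shows "composite_matrix k m A B $$ (p, q) =
    A (q div k) $$ (p mod k, q mod k) + B (p mod k) $$ (p div k, q div k)"
proof -
  let ?f = "\<lambda>r. map (\<lambda>u. composite_row m A B r u) [0..<k]"
  have "k > 0" using assms(2) by (auto intro: gr0I)
  have len: "length (concat (map ?f [0..<m])) = m * k"
    by (rule length_concat_uniform) simp
  have "concat (map ?f [0..<m]) ! p = ?f (p div k) ! (p mod k)"
    using assms(2) by (intro nth_concat_uniform) simp_all
  also have "\<dots> = composite_row m A B (p div k) (p mod k)"
    using \<open>k > 0\<close> by simp
  finally have "composite_matrix k m A B $$ (p, q) = composite_row m A B (p div k) (p mod k) $ q"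
    unfolding composite_matrix_def using mat_of_rows_index len assms(2,3) by metis
  then show ?thesis
    using composite_row_index[of m A k "p mod k" q B "p div k"] assms \<open>k > 0\<close> by simp
qed

lemma sum_div_mod:
  fixes g :: "nat \<Rightarrow> nat \<Rightarrow> 'a::comm_monoid_add"
  shows "(\<Sum>q<m * k. g (q div k) (q mod k)) = (\<Sum>j<m. \<Sum>c<k. g j c)"
proof -
  have "(\<Sum>q<m * k. g (q div k) (q mod k)) =
      (\<Sum>j<m. \<Sum>q = j * k..<j * k + k. g (q div k) (q mod k))"
    by (simp add: sum.nat_group)
  also have "\<dots> = (\<Sum>j<m. \<Sum>c<k. g j c)"
  proof (rule sum.cong[OF refl])
    fix j
    show "(\<Sum>q = j * k..<j * k + k. g (q div k) (q mod k)) = (\<Sum>c<k. g j c)"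
      using sum.shift_bounds_nat_ivl[of "\<lambda>q. g (q div k) (q mod k)" 0 "j * k" k]
      by (simp add: lessThan_atLeast0 add.commute)
  qed
  finally show ?thesis .
qed

theorem theorem2p2:
  fixes k m :: nat and A B :: "nat \<Rightarrow> bit mat"
  assumes "k > 0" and "m > 0"
    and "\<And>j. j < m \<Longrightarrow> binary_hadamard_matrix k (A j)"
    and "\<And>u. u < k \<Longrightarrow> binary_hadamard_matrix m (B u)"
  shows "binary_hadamard_matrix (m * k) (composite_matrix k m A B)"
proof -
  let ?H = "composite_matrix k m A B"
  let ?a = "\<lambda>j u c. sign_of_bit (A j $$ (u, c))"
  let ?b = "\<lambda>u r j. sign_of_bit (B u $$ (r, j))"
  have carrier: "A j \<in> carrier_mat k k" if "j < m" for j
    using assms(3)[OF that] by (simp add: binary_hadamard_matrix_iff)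
  have A_orth: "(\<Sum>c<k. ?a j u c * ?a j u' c) = (if u = u' then int k else 0)"
    if "j < m" "u < k" "u' < k" for j u u'
    using assms(3)[OF that(1)] that by (simp add: binary_hadamard_matrix_iff)
  have B_orth: "(\<Sum>j<m. ?b u r j * ?b u r' j) = (if r = r' then int m else 0)"
    if "u < k" "r < m" "r' < m" for u r r'
    using assms(4)[OF that(1)] that by (simp add: binary_hadamard_matrix_iff)
  have H_sign: "sign_of_bit (?H $$ (p, q)) =
      ?a (q div k) (p mod k) (q mod k) * ?b (p mod k) (p div k) (q div k)"
    if "p < m * k" "q < m * k" for p q
    by (simp only: composite_matrix_index[OF carrier that] sign_of_bit_add)
  have "(\<Sum>q<m * k. sign_of_bit (?H $$ (p, q)) * sign_of_bit (?H $$ (p', q))) =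
      (if p = p' then int (m * k) else 0)" if p: "p < m * k" and p': "p' < m * k" for p p'
  proof -
    define r u r' u' where "r = p div k" and "u = p mod k" and "r' = p' div k" and "u' = p' mod k"
    have bounds: "r < m" "u < k" "r' < m" "u' < k"
      using p p' \<open>k > 0\<close> by (simp_all add: r_def u_def r'_def u'_def less_mult_imp_div_less)
    have same_row: "p = p' \<longleftrightarrow> u = u' \<and> r = r'"
      unfolding r_def u_def r'_def u'_def by (metis div_mult_mod_eq)
    have "(\<Sum>q<m * k. sign_of_bit (?H $$ (p, q)) * sign_of_bit (?H $$ (p', q))) =
        (\<Sum>q<m * k. ?b u r (q div k) * ?b u' r' (q div k) *
          (?a (q div k) u (q mod k) * ?a (q div k) u' (q mod k)))"
      by (intro sum.cong) (simp_all only: lessThan_iff H_sign[OF p] H_sign[OF p']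
          r_def u_def r'_def u'_def mult_ac)
    also have "\<dots> = (\<Sum>j<m. \<Sum>c<k. ?b u r j * ?b u' r' j * (?a j u c * ?a j u' c))"
      by (rule sum_div_mod)
    also have "\<dots> = (\<Sum>j<m. ?b u r j * ?b u' r' j * (\<Sum>c<k. ?a j u c * ?a j u' c))"
      by (simp only: sum_distrib_left)
    also have "\<dots> = (\<Sum>j<m. ?b u r j * ?b u' r' j) * (if u = u' then int k else 0)"
      using A_orth bounds by (simp add: sum_distrib_right)
    also have "\<dots> = (if p = p' then int (m * k) else 0)"
      using B_orth bounds by (simp add: same_row)
    finally show ?thesis .
  qed
  then show ?thesis
    using composite_matrix_carrier by (simp add: binary_hadamard_matrix_iff)
qed

end
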